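(* Let $p,q\ge1$ be integers, let $X\subset\mathbb{R}^p$ and $Y\subset\mathbb{R}^q$ be bounded open sets, and let $Z:=X\times Y\subset\mathbb{R}^{p+q}$. Let $\phi:X\to(0,\infty]$ be a Borel function whose decreasing rearrangement $\phi^*$ satisfies \[ \int_0^1\log^+\phi^*(t^p)\,dt<\infty. \] Let $\mathcal{U}(Z,\phi)$ be the family of all subharmonic functions $u$ on $Z$ such that $u(x,y)\le\phi(x)$ for all $x\in X$, $y\in Y$. Then there exists a decreasing function $\psi:[0,\infty)\to[0,\infty]$ such that \[ \sup_{u\in\mathcal{U}(Z,\phi)}u(z)\le\psi\bigl(\operatorname{dist}(z,\partial Z)\bigr)\quad\text{for all } z\in Z, \] and such that, for all $\alpha,\beta$ with $0<\alpha<\beta<1$ and all $t\in(0,m_p(X)^{1/p})$, \[ \psi\Bigl(\frac{1}{\alpha^{1/p}\log(1/\beta)}\Bigl(\frac{V_q}{V_{p+q}}\Bigr)^{1/p}\int_0^t\log\Bigl(\frac{\phi^*(s^p)}{\phi^*(t^p)}\Bigr)\,ds\Bigr)\le\frac{\phi^*(t^p-)}{\beta-\alpha}. \]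
   Context: "Decreasing" means non-increasing. $\log^+(x):=\log\max\{x,1\}$. $m_d$ is Lebesgue measure on $\mathbb{R}^d$, and $V_d=\pi^{d/2}/\Gamma(1+d/2)$ is the $m_d$-volume of the Euclidean unit ball in $\mathbb{R}^d$. For a Borel set $X\subset\mathbb{R}^d$ with $0<m_d(X)<\infty$ and a Borel function $\phi:X\to[0,\infty]$, the decreasing rearrangement of $\phi$ is the unique right-continuous decreasing function $\phi^*:(0,\infty)\to[0,\infty]$ such that $m_d\{\phi>t\}=m_1\{\phi^*>t\}$ for all $t>0$. $\phi^*(x-):=\lim_{y\to x^-}\phi^*(y)$. Distances are Euclidean. Subharmonic functions are upper semicontinuous functions with values in $[-\infty,\infty)$ satisfying the sub-mean value inequality on closed balls contained in the domain. *)

theory Defs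
  imports "HOL-Analysis.Analysis"
begin

text \<open>
  Here \<open>\<phi>'\<close> is a function on \<open>(0, \<infinity>)\<close>: its values at nonpositive arguments are
  unconstrained. The equimeasurability condition is stated for Lebesgue measure restricted to
  the Borel sets, which loses nothing, as for Borel \<open>\<phi>\<close> and decreasing \<open>\<phi>'\<close> the superlevel
  sets are Borel.
\<close>

definition is_decreasing_rearrangement ::
    "'a::euclidean_space set \<Rightarrow> ('a \<Rightarrow> ennreal) \<Rightarrow> (real \<Rightarrow> ennreal) \<Rightarrow> bool" where
  "is_decreasing_rearrangement X \<phi> \<phi>' \<longleftrightarrow>
     antimono_on {0<..} \<phi>' \<and>
     (\<forall>x>0. continuous (at_right x) \<phi>') \<and>
     (\<forall>t::real. t > 0 \<longrightarrow>
        emeasure lborel {x \<in> X. \<phi> x > ennreal t} =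
        emeasure lborel {s \<in> {0<..}. \<phi>' s > ennreal t})"

definition log_plus :: "ennreal \<Rightarrow> ennreal" where
  "log_plus x = (if x = \<infinity> then \<infinity> else ennreal (ln (max (enn2real x) 1)))"

definition upper_semicontinuous_on :: "'a::topological_space set \<Rightarrow> ('a \<Rightarrow> ereal) \<Rightarrow> bool" where
  "upper_semicontinuous_on S u \<longleftrightarrow>
     (\<forall>x\<in>S. \<forall>c. u x < c \<longrightarrow> (\<forall>\<^sub>F y in at x within S. u y < c))"

text \<open>
  The Lebesgue integral with values in \<open>[-\<infinity>, \<infinity>]\<close>; \<^const>\<open>e2ennreal\<close> truncates negative values
  to \<open>0\<close>. It is used only for upper semicontinuous functions with values in \<open>[-\<infinity>, \<infinity>)\<close> on compact
  sets; these are bounded above, so that the positive part has a finite integral and no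
  \<open>\<infinity> - \<infinity>\<close> arises.
\<close>

definition ereal_set_integral :: "'a::euclidean_space set \<Rightarrow> ('a \<Rightarrow> ereal) \<Rightarrow> ereal" where
  "ereal_set_integral A u =
     enn2ereal (\<integral>\<^sup>+x\<in>A. e2ennreal (u x) \<partial>lborel) - enn2ereal (\<integral>\<^sup>+x\<in>A. e2ennreal (- u x) \<partial>lborel)"

text \<open>The function that is identically \<open>-\<infinity>\<close> is allowed.\<close>

definition subharmonic_on :: "'a::euclidean_space set \<Rightarrow> ('a \<Rightarrow> ereal) \<Rightarrow> bool" where
  "subharmonic_on S u \<longleftrightarrow>
     (\<forall>x\<in>S. u x < \<infinity>) \<and>
     upper_semicontinuous_on S u \<and>
     (\<forall>x r. r > 0 \<and> cball x r \<subseteq> S \<longrightarrow>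
        u x \<le> ereal_set_integral (cball x r) u / ereal (measure lborel (cball x r)))"

definition subharmonic_minorants ::
    "'a::euclidean_space set \<Rightarrow> 'b::euclidean_space set \<Rightarrow> ('a \<Rightarrow> ennreal) \<Rightarrow> ('a \<times> 'b \<Rightarrow> ereal) set"
  where
  "subharmonic_minorants X Y \<phi> =
     {u. subharmonic_on (X \<times> Y) u \<and> (\<forall>x\<in>X. \<forall>y\<in>Y. u (x, y) \<le> enn2ereal (\<phi> x))}"

end

theory Submission
  imports Defs
begin

text \<open>
  A ball of radius \<open>r\<close> in \<open>X \<times> Y\<close> on which a minorant \<open>u\<close> of \<open>\<phi>\<close> is less than \<open>S\<close> splits into the
  part over \<open>{\<phi> > c}\<close>, where \<open>u < S\<close>, and the rest, where \<open>u \<le> \<phi> \<le> c\<close>. The first part lies in a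
  cylinder, so that it occupies at most the fraction \<open>\<alpha>\<close> of the ball as soon as
  \<open>r\<^sup>p \<ge> V\<^sub>q m\<^sub>p{\<phi> > c} / (\<alpha> V)\<close>, with \<open>V\<close> the volume of the unit ball of the product space and
  \<open>p\<close>, \<open>q\<close> the dimensions of the factors. With \<open>c = (1 - \<alpha>/\<beta>) M\<close> and \<open>S = M/\<beta>\<close> the mean of
  \<open>u\<close> is then less than \<open>M\<close>. Hence, if \<open>u \<ge> M\<close> at the centre, then \<open>u \<ge> M/\<beta>\<close> somewhere
  in the ball (\<open>subharmonic_minorant_jump\<close>).

  This can be repeated: each step multiplies the value by \<open>1/\<beta>\<close>, and the radius needed at the next
  level is no larger, because \<open>m\<^sub>p{\<phi> > c}\<close> decreases in \<open>c\<close>. If the radii sum up to less than the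
  distance to the boundary, then \<open>u\<close> is unbounded on a compact ball inside \<open>X \<times> Y\<close>, which upper
  semicontinuity forbids (\<open>subharmonic_minorant_less\<close>).

  It remains to bound the sum of the radii. Put \<open>L = (\<beta> - \<alpha>) M\<close>; the levels of \<open>\<phi>\<close> that occur are
  \<open>L \<beta>\<^sup>-\<^sup>1, L \<beta>\<^sup>-\<^sup>2, \<dots>\<close>. Up to the constant, the radius for the level \<open>c\<close> is the length of the
  interval \<open>{s > 0. \<phi>'(s\<^sup>p) > c}\<close>. A point \<open>s\<close> with \<open>\<phi>'(s\<^sup>p) > L\<close> lies in at most
  \<open>log(\<phi>'(s\<^sup>p) / L) / log(1/\<beta>)\<close> of these intervals, so that the integral of this quantity bounds
  the sum (\<open>sum_lengths_le_integral\<close>). It is important that the first level is \<open>L/\<beta>\<close> and not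
  \<open>L\<close>: the latter would add 1 to the count. If \<open>L > \<phi>'(t\<^sup>p-)\<close>, then all intervals lie in
  \<open>(0, t)\<close>, and replacing \<open>L\<close> by the smaller \<open>\<phi>'(t\<^sup>p)\<close> makes the integral strictly larger, unless
  \<open>{\<phi>' > L}\<close> is null, and then all the intervals are empty. So at distance at
  least the stated multiple of the integral no minorant can exceed \<open>\<phi>'(t\<^sup>p-) / (\<beta> - \<alpha>)\<close> (\<open>minorant_le_of_deep\<close>), and \<open>\<psi> \<delta>\<close> can be taken as the
  supremum of the positive parts of all minorants over all points at distance at least \<open>\<delta>\<close> from
  the boundary.
\<close>

section \<open>Superlevel sets, balls and cylinders\<close>

text \<open>The distribution function of \<open>\<phi>\<close>. It is real valued since it is used for bounded \<open>X\<close> only, where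
  no infinite measure is replaced by \<open>0\<close>.\<close>

definition superlevel_content :: "'a::euclidean_space set \<Rightarrow> ('a \<Rightarrow> ennreal) \<Rightarrow> real \<Rightarrow> real" where
  "superlevel_content X \<phi> c = measure lborel {x \<in> X. \<phi> x > ennreal c}"

lemma upper_semicontinuous_on_bounded_above:
  fixes u :: "'a::topological_space \<Rightarrow> ereal"
  assumes usc: "upper_semicontinuous_on S u" and fin: "\<forall>x\<in>S. u x < \<infinity>"
    and K: "compact K" "K \<subseteq> S"
  shows "\<exists>c::real. \<forall>x\<in>K. u x \<le> ereal c"
proof -
  have "\<exists>T c. open T \<and> x \<in> T \<and> (\<forall>y\<in>T \<inter> S. u y \<le> ereal c)" if "x \<in> K" for x
  proof -
    have "x \<in> S" using that K by auto
    then obtain c where c: "u x < ereal c"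
      using fin less_PInf_Ex_of_nat by (metis less_irrefl)
    then obtain T where "open T" "x \<in> T" "\<forall>y\<in>T. y \<noteq> x \<longrightarrow> y \<in> S \<longrightarrow> u y < ereal c"
      using usc \<open>x \<in> S\<close> unfolding upper_semicontinuous_on_def eventually_at_topological by blast
    then show ?thesis using c by (metis IntE less_imp_le)
  qed
  then obtain T c where T: "\<And>x. x \<in> K \<Longrightarrow> open (T x) \<and> x \<in> T x \<and> (\<forall>y\<in>T x \<inter> S. u y \<le> ereal (c x))"
    by metis
  obtain C where C: "C \<subseteq> K" "finite C" "K \<subseteq> (\<Union>x\<in>C. T x)"
    by (rule compactE_image[OF K(1), of K T]) (use T in auto)
  show ?thesis
  proof (cases "C = {}")
    case True
    then show ?thesis using C by auto
  next
    case False
    have "u y \<le> ereal (Max (c ` C))" if y: "y \<in> K" for y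
    proof -
      obtain x where x: "x \<in> C" "y \<in> T x" using C y by blast
      then have "u y \<le> ereal (c x)" using T[of x] C K y by blast
      also have "\<dots> \<le> ereal (Max (c ` C))" using C x by simp
      finally show ?thesis .
    qed
    then show ?thesis by blast
  qed
qed

text \<open>A ball is connected, so it cannot leave \<open>Z\<close> without meeting the frontier.\<close>

lemma cball_subset_of_infdist_frontier:
  fixes z :: "'a::euclidean_space"
  assumes "z \<in> Z" "0 \<le> r" "r < infdist z (frontier Z)"
  shows "cball z r \<subseteq> Z"
proof (rule ccontr)
  assume "\<not> cball z r \<subseteq> Z"
  then have "cball z r \<inter> frontier Z \<noteq> {}"
    using assms centre_in_cball[of z r] by (intro connected_Int_frontier) blast+
  then obtain w where "w \<in> frontier Z" "dist z w \<le> r" by auto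
  then show False using infdist_le[of w "frontier Z" z] assms by simp
qed

lemma superlevel_sets [measurable]:
  fixes X :: "'a::euclidean_space set"
  assumes "open X" "\<phi> \<in> borel_measurable (restrict_space borel X)"
  shows "{x \<in> X. \<phi> x > (c::ennreal)} \<in> sets borel"
proof -
  have "{x \<in> space (restrict_space borel X). c < \<phi> x} \<in> sets (restrict_space borel X)"
    using assms(2) by measurable
  then show ?thesis using assms(1)
    by (auto simp: sets_restrict_space_iff space_restrict_space)
qed

lemma superlevel_emeasure:
  fixes X :: "'a::euclidean_space set"
  assumes "bounded X"
  shows "emeasure lborel {x \<in> X. \<phi> x > ennreal c} = ennreal (superlevel_content X \<phi> c)"
proof -
  have "bounded {x \<in> X. \<phi> x > ennreal c}" by (rule bounded_subset[OF assms]) auto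
  then have "emeasure lborel {x \<in> X. \<phi> x > ennreal c} \<noteq> \<infinity>"
    using emeasure_bounded_finite by force
  then show ?thesis unfolding superlevel_content_def by (simp add: emeasure_eq_ennreal_measure)
qed

lemma superlevel_content_antimono:
  fixes X :: "'a::euclidean_space set"
  assumes "open X" "bounded X" "\<phi> \<in> borel_measurable (restrict_space borel X)" "c \<le> c'"
  shows "superlevel_content X \<phi> c' \<le> superlevel_content X \<phi> c"
proof -
  have "emeasure lborel {x \<in> X. \<phi> x > ennreal c'} \<le> emeasure lborel {x \<in> X. \<phi> x > ennreal c}"
    using superlevel_sets[OF assms(1,3)] assms(4)
    by (intro emeasure_mono) (auto intro: le_less_trans[OF ennreal_leI])
  then show ?thesis
    unfolding superlevel_emeasure[OF assms(2)]
    by (simp add: superlevel_content_def)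
qed

lemma superlevel_content_nonneg: "0 \<le> superlevel_content X \<phi> c"
  by (simp add: superlevel_content_def)

lemma cylinder_emeasure:
  fixes A :: "'a::euclidean_space set" and y :: "'b::euclidean_space"
  assumes "A \<in> sets borel" "0 \<le> r"
  shows "emeasure lborel (A \<times> cball y r) =
    emeasure lborel A * ennreal (unit_ball_vol (DIM('b)) * r ^ DIM('b))"
  unfolding lborel_prod[symmetric]
  using assms by (subst lborel.emeasure_pair_measure_Times) (auto simp: emeasure_cball)

section \<open>Growth of subharmonic minorants\<close>

text \<open>The sub-mean value inequality with the negative part of \<open>u\<close> dropped and the volume multiplied out, which
  leaves one nonnegative integral to estimate.\<close>

lemma subharmonic_le_nn_integral:
  assumes "subharmonic_on Z u" "0 < r" "cball z r \<subseteq> Z"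
  shows "u z * ereal (measure lborel (cball z r)) \<le>
    enn2ereal (\<integral>\<^sup>+x\<in>cball z r. e2ennreal (u x) \<partial>lborel)"
proof -
  let ?V = "measure lborel (cball z r)"
  let ?P = "\<integral>\<^sup>+x\<in>cball z r. e2ennreal (u x) \<partial>lborel"
  have V: "?V > 0" using assms by simp
  have "u z \<le> ereal_set_integral (cball z r) u / ereal ?V"
    using assms unfolding subharmonic_on_def by blast
  also have "\<dots> \<le> enn2ereal ?P / ereal ?V"
  proof (rule ereal_divide_right_mono)
    show "ereal_set_integral (cball z r) u \<le> enn2ereal ?P"
      unfolding ereal_set_integral_def
      by (metis diff_zero ereal_minus(7) ereal_minus_mono enn2ereal_nonneg order_refl)
  qed (use V in simp)
  finally show ?thesis using V
    by (simp add: ereal_le_divide_pos mult.commute)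
qed

text \<open>
  The two bounds \<open>c\<close> off the cylinder and \<open>S = M/\<beta>\<close> on it give a mean of at most
  \<open>(1 - \<alpha>) c + \<alpha> S\<close>, which for \<open>c = (1 - \<alpha>/\<beta>) M\<close> is \<open>M - \<alpha> c < M\<close>. This \<open>c\<close> is the best that the
  cruder bound \<open>c + \<alpha> S \<le> M\<close> permits.
\<close>

lemma subharmonic_minorant_jump:
  fixes X :: "'a::euclidean_space set" and Y :: "'b::euclidean_space set"
  assumes X: "open X" "bounded X" and \<phi>: "\<phi> \<in> borel_measurable (restrict_space borel X)"
    and u: "u \<in> subharmonic_minorants X Y \<phi>"
    and r: "0 < r" "cball z r \<subseteq> X \<times> Y"
    and ab: "0 < \<alpha>" "\<alpha> < \<beta>" "\<beta> < 1"
    and M: "0 < M" "ereal M \<le> u z"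
    and small: "unit_ball_vol (DIM('b)) * superlevel_content X \<phi> ((1 - \<alpha> / \<beta>) * M)
                \<le> \<alpha> * unit_ball_vol (DIM('a) + DIM('b)) * r ^ DIM('a)"
  shows "\<exists>w\<in>cball z r. ereal (M / \<beta>) \<le> u w"
proof (rule ccontr)
  assume "\<not> ?thesis"
  then have neg: "\<And>w. w \<in> cball z r \<Longrightarrow> u w < ereal (M / \<beta>)" by force
  define c where "c = (1 - \<alpha> / \<beta>) * M"
  define S where "S = M / \<beta>"
  define A where "A = {x \<in> X. \<phi> x > ennreal c}"
  define V where "V = measure lborel (cball z r)"
  have V: "V > 0" using r by (simp add: V_def)
  have V_eq: "V = unit_ball_vol (DIM('a) + DIM('b)) * r ^ (DIM('a) + DIM('b))"
    using r by (simp add: V_def content_cball)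
  have eV: "emeasure lborel (cball z r) = ennreal V"
    using r by (simp add: V_eq emeasure_cball)
  have c0: "0 < c" using ab M by (simp add: c_def field_simps)
  have "c \<le> 1 * M" unfolding c_def using ab M by (intro mult_right_mono) auto
  also have "1 * M \<le> S" using ab M by (simp add: S_def field_simps)
  finally have c: "0 < c" "c \<le> S" using c0 by auto
  have A: "A \<in> sets borel" unfolding A_def by (rule superlevel_sets[OF X(1) \<phi>])
  have sub: "subharmonic_on (X \<times> Y) u" and le: "\<And>x y. x \<in> X \<Longrightarrow> y \<in> Y \<Longrightarrow> u (x, y) \<le> enn2ereal (\<phi> x)"
    using u by (auto simp: subharmonic_minorants_def)
  have cyl_L: "A \<times> cball (snd z) r \<in> sets lborel"
    using A by (simp add: borel_prod[symmetric])
  have ball_L: "cball z r \<in> sets lborel" by simp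
  have pw: "e2ennreal (u w) * indicator (cball z r) w \<le>
     ennreal c * indicator (cball z r) w + ennreal (S - c) * indicator (A \<times> cball (snd z) r) w" for w
  proof (cases "w \<in> cball z r")
    case w: True
    obtain x y where xy: "w = (x, y)" by (cases w)
    have XY: "x \<in> X" "y \<in> Y" using w r xy by auto
    have y: "y \<in> cball (snd z) r" using w dist_snd_le[of z w] by (simp add: xy)
    show ?thesis
    proof (cases "x \<in> A")
      case True
      have "e2ennreal (u w) \<le> e2ennreal (ereal S)"
        using neg[OF w] unfolding S_def by (intro e2ennreal_mono) auto
      also have "\<dots> = ennreal c + ennreal (S - c)" using c by (simp flip: ennreal_plus)
      finally show ?thesis using w True y by (simp add: xy)
    next
      case False
      then have "\<phi> x \<le> ennreal c" using XY by (auto simp: A_def)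
      then have "enn2ereal (\<phi> x) \<le> ereal c" using c
        by (metis enn2ereal_ennreal less_eq_ennreal.rep_eq less_imp_le)
      then have "u w \<le> ereal c" using le[OF XY] xy by simp
      then have "e2ennreal (u w) \<le> ennreal c" using e2ennreal_mono by fastforce
      then show ?thesis using w by (simp add: add_increasing2)
    qed
  qed simp
  have "(\<integral>\<^sup>+w\<in>cball z r. e2ennreal (u w) \<partial>lborel) \<le>
     (\<integral>\<^sup>+w. ennreal c * indicator (cball z r) w
        + ennreal (S - c) * indicator (A \<times> cball (snd z) r) w \<partial>lborel)"
    by (intro nn_integral_mono pw)
  also have "\<dots> = ennreal c * ennreal V + ennreal (S - c) * emeasure lborel (A \<times> cball (snd z) r)"
    using cyl_L ball_L
    by (subst nn_integral_add)
      (auto intro!: borel_measurable_times_ennreal borel_measurable_indicator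
        simp add: nn_integral_cmult_indicator eV simp del: sets_lborel)
  also have "emeasure lborel (A \<times> cball (snd z) r) =
      ennreal (superlevel_content X \<phi> c * (unit_ball_vol (DIM('b)) * r ^ DIM('b)))"
    using A r X by (simp add: cylinder_emeasure A_def superlevel_emeasure ennreal_mult
        superlevel_content_nonneg)
  also have "ennreal c * ennreal V + ennreal (S - c) * \<dots> \<le>
      ennreal c * ennreal V + ennreal (S - c) * ennreal (\<alpha> * V)"
  proof (intro add_left_mono mult_left_mono ennreal_leI)
    show "superlevel_content X \<phi> c * (unit_ball_vol (DIM('b)) * r ^ DIM('b)) \<le> \<alpha> * V"
      using mult_right_mono[OF small, of "r ^ DIM('b)"] r
      by (simp add: V_eq c_def power_add mult_ac)
  qed auto
  also have "\<dots> = ennreal ((c + (S - c) * \<alpha>) * V)"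
    using c V ab by (simp add: ennreal_mult[symmetric] ennreal_plus[symmetric] algebra_simps
        del: ennreal_plus)
  finally have "enn2ereal (\<integral>\<^sup>+w\<in>cball z r. e2ennreal (u w) \<partial>lborel) \<le> ereal ((c + (S - c) * \<alpha>) * V)"
    using c V ab by (metis (no_types, lifting) add_nonneg_nonneg diff_ge_0_iff_ge enn2ereal_ennreal
        less_eq_ennreal.rep_eq less_imp_le mult_nonneg_nonneg)
  then have "u z * ereal V \<le> ereal ((c + (S - c) * \<alpha>) * V)"
    using subharmonic_le_nn_integral[OF sub r] by (simp add: V_def)
  moreover have "ereal (M * V) \<le> u z * ereal V"
    using ereal_mult_right_mono[OF M(2), of "ereal V"] V by simp
  ultimately have "M * V \<le> (c + (S - c) * \<alpha>) * V"
    using ereal_less_eq(3) order_trans by blast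
  then have "M \<le> c + (S - c) * \<alpha>" using V by simp
  moreover have "c + (S - c) * \<alpha> = M - M * (\<alpha> * (1 - \<alpha> / \<beta>))"
    using ab by (simp add: c_def S_def field_simps)
  moreover have "M * (\<alpha> * (1 - \<alpha> / \<beta>)) > 0" using ab M by (simp add: field_simps)
  ultimately show False by simp
qed


text \<open>
  The bound on the partial sums is strictly below the distance to the frontier. The gap \<open>\<eta>\<close> is used
  to enlarge each radius a little: the radius from the hypothesis is \<open>0\<close> at levels that \<open>\<phi>\<close>
  exceeds only on a null set, and the jump needs a proper ball.
\<close>

lemma subharmonic_minorant_less:
  fixes X :: "'a::euclidean_space set" and Y :: "'b::euclidean_space set"
  assumes X: "open X" "bounded X" and \<phi>: "\<phi> \<in> borel_measurable (restrict_space borel X)"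
    and u: "u \<in> subharmonic_minorants X Y \<phi>"
    and z: "z \<in> X \<times> Y"
    and ab: "0 < \<alpha>" "\<alpha> < \<beta>" "\<beta> < 1"
    and M: "0 < M"
    and rad: "\<And>n. (\<Sum>j<n. root DIM('a) (unit_ball_vol (DIM('b)) /
                (\<alpha> * unit_ball_vol (DIM('a) + DIM('b)))
              * superlevel_content X \<phi> ((1 - \<alpha> / \<beta>) * (M / \<beta> ^ j)))) \<le> B"
    and B: "B < infdist z (frontier (X \<times> Y))"
  shows "u z < ereal M"
proof (rule ccontr)
  assume "\<not> u z < ereal M"
  then have uz: "ereal M \<le> u z" by simp
  define C where "C = unit_ball_vol (DIM('b)) / (\<alpha> * unit_ball_vol (DIM('a) + DIM('b)))"
  define \<mu> where "\<mu> j = superlevel_content X \<phi> ((1 - \<alpha> / \<beta>) * (M / \<beta> ^ j))" for j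
  define \<eta> where "\<eta> = infdist z (frontier (X \<times> Y)) - B"
  define R where "R j = root DIM('a) (C * \<mu> j) + \<eta> * (1/2) ^ j / 4" for j
  define \<rho> where "\<rho> = B + \<eta> / 2"
  have \<eta>: "\<eta> > 0" using B by (simp add: \<eta>_def)
  have C: "C \<ge> 0" using ab by (simp add: C_def)
  have \<mu>: "\<mu> j \<ge> 0" for j by (simp add: \<mu>_def superlevel_content_nonneg)
  have root_nn: "root DIM('a) (C * \<mu> j) \<ge> 0" for j using C \<mu> by simp
  have R_pos: "R j > 0" for j
    unfolding R_def using root_nn[of j] \<eta> by (intro add_nonneg_pos) auto
  have geom: "(\<Sum>j<n. \<eta> * (1/2) ^ j / 4) \<le> \<eta> / 2" for n
  proof -
    have "(\<Sum>j<n. \<eta> * (1/2) ^ j / 4) = \<eta> / 4 * (\<Sum>j<n. (1/2) ^ j)"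
      by (simp add: sum_distrib_left field_simps)
    also have "(\<Sum>j<n. (1/2::real) ^ j) = 2 * (1 - (1/2) ^ n)"
      by (simp add: sum_gp_strict)
    also have "\<eta> / 4 * \<dots> \<le> \<eta> / 4 * 2" using \<eta> by (intro mult_left_mono) auto
    finally show ?thesis by simp
  qed
  have sum_R: "(\<Sum>j<n. R j) \<le> \<rho>" for n
    unfolding R_def sum.distrib \<rho>_def
    using rad[of n] geom[of n] by (intro add_mono) (auto simp: C_def \<mu>_def)
  have \<rho>: "0 \<le> \<rho>" "\<rho> < infdist z (frontier (X \<times> Y))"
    using sum_R[of 0] \<eta> by (auto simp: \<rho>_def \<eta>_def field_simps)
  have ball: "cball z \<rho> \<subseteq> X \<times> Y" by (rule cball_subset_of_infdist_frontier[OF z \<rho>])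
  have climb: "\<exists>w\<in>cball z (\<Sum>j<n. R j). ereal (M / \<beta> ^ n) \<le> u w" for n
  proof (induction n)
    case 0
    then show ?case using uz by simp
  next
    case (Suc n)
    then obtain w where w: "dist z w \<le> (\<Sum>j<n. R j)" "ereal (M / \<beta> ^ n) \<le> u w" by auto
    have step: "cball w (R n) \<subseteq> cball z (\<Sum>j<Suc n. R j)"
      using w(1) by (intro subsetI) (auto intro: order_trans[OF dist_triangle[of z _ w]])
    also have "\<dots> \<subseteq> cball z \<rho>" using sum_R[of "Suc n"] by (rule subset_cball)
    also note ball
    finally have in_Z: "cball w (R n) \<subseteq> X \<times> Y" .
    have "C * \<mu> n \<le> R n ^ DIM('a)"
    proof -
      have "C * \<mu> n = root DIM('a) (C * \<mu> n) ^ DIM('a)"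
        using C \<mu>[of n] by simp
      also have "\<dots> \<le> R n ^ DIM('a)"
        using root_nn[of n] \<eta> by (intro power_mono) (auto simp: R_def)
      finally show ?thesis .
    qed
    then have small: "unit_ball_vol (DIM('b)) * \<mu> n
                \<le> \<alpha> * unit_ball_vol (DIM('a) + DIM('b)) * R n ^ DIM('a)"
      using ab by (simp add: C_def pos_divide_le_eq mult_ac)
    have "\<exists>v\<in>cball w (R n). ereal (M / \<beta> ^ n / \<beta>) \<le> u v"
      using ab M w small
      by (intro subharmonic_minorant_jump[OF X \<phi> u R_pos in_Z ab]) (auto simp: \<mu>_def)
    then show ?case using step by (auto simp: mult_ac)
  qed
  have sub: "subharmonic_on (X \<times> Y) u" using u by (simp add: subharmonic_minorants_def)
  obtain c where c: "\<And>w. w \<in> cball z \<rho> \<Longrightarrow> u w \<le> ereal c"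
    using upper_semicontinuous_on_bounded_above[of "X \<times> Y" u "cball z \<rho>"] sub ball compact_cball
    unfolding subharmonic_on_def by metis
  obtain n where n: "c / M < (1 / \<beta>) ^ n"
    using real_arch_pow[of "1 / \<beta>"] ab by auto
  obtain w where w: "w \<in> cball z (\<Sum>j<n. R j)" "ereal (M / \<beta> ^ n) \<le> u w"
    using climb by blast
  then have "M / \<beta> ^ n \<le> c" using c[of w] sum_R[of n]
    by (metis ereal_less_eq(3) mem_cball order_trans)
  then show False using n M by (simp add: field_simps)
qed

section \<open>The decreasing rearrangement\<close>

text \<open>
  By monotonicity \<open>{\<phi>' > c}\<close> lies in \<open>(0, y)\<close>. Read contrapositively, the lemma says that \<open>\<phi>'\<close> exceeds \<open>c\<close> on all of \<open>(0, m{\<phi> > c})\<close>.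
\<close>

lemma rearrangement_superlevel_le:
  fixes X :: "'a::euclidean_space set"
  assumes rearr: "is_decreasing_rearrangement X \<phi> \<phi>'" and X: "bounded X"
    and y: "0 < y" "0 < c" "\<phi>' y \<le> ennreal c"
  shows "superlevel_content X \<phi> c \<le> y"
proof -
  have "{s \<in> {0<..}. \<phi>' s > ennreal c} \<subseteq> {0<..<y}"
  proof
    fix s assume s: "s \<in> {s \<in> {0<..}. \<phi>' s > ennreal c}"
    have "s < y"
    proof (rule ccontr)
      assume "\<not> s < y"
      then have "\<phi>' s \<le> \<phi>' y"
        using rearr y s unfolding is_decreasing_rearrangement_def
        by (intro monotone_onD[of "{0<..}" "(\<le>)" "(\<ge>)" \<phi>']) auto
      then show False using s y(3) by auto
    qed
    then show "s \<in> {0<..<y}" using s by simp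
  qed
  then have "emeasure lborel {s \<in> {0<..}. \<phi>' s > ennreal c} \<le> emeasure lborel {0<..<y}"
    by (rule emeasure_mono) simp
  then have "emeasure lborel {x \<in> X. \<phi> x > ennreal c} \<le> ennreal y"
    using rearr y unfolding is_decreasing_rearrangement_def by simp
  then show ?thesis using y by (simp add: superlevel_emeasure[OF X])
qed

text \<open>
  If \<open>\<phi>'\<close> vanished at \<open>y\<close>, all sets \<open>{\<phi> > 1/n}\<close> would have measure at most \<open>y\<close>; but they
  exhaust \<open>X\<close>. Positivity makes the denominator in the logarithm of the theorem harmless.
\<close>

lemma rearrangement_pos:
  fixes X :: "'a::euclidean_space set"
  assumes rearr: "is_decreasing_rearrangement X \<phi> \<phi>'" and X: "open X" "bounded X"
    and \<phi>: "\<phi> \<in> borel_measurable (restrict_space borel X)" "\<forall>x\<in>X. \<phi> x > 0"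
    and y: "0 < y" "y < measure lborel X"
  shows "0 < \<phi>' y"
proof (rule ccontr)
  assume "\<not> 0 < \<phi>' y"
  then have zero: "\<phi>' y = 0" by simp
  define A where "A n = {x \<in> X. \<phi> x > ennreal (1 / Suc n)}" for n
  have "incseq A"
  proof (rule incseq_SucI, rule subsetI)
    fix n x assume "x \<in> A n"
    then show "x \<in> A (Suc n)"
      unfolding A_def using le_less_trans[OF ennreal_leI, of "1 / Suc (Suc n)" "1 / Suc n" "\<phi> x"]
      by (simp add: field_simps)
  qed
  moreover have "range A \<subseteq> sets lborel"
    using superlevel_sets[OF X(1) \<phi>(1)] by (auto simp: A_def)
  ultimately have "(SUP n. emeasure lborel (A n)) = emeasure lborel (\<Union>n. A n)"
    by (intro SUP_emeasure_incseq)
  also have "(\<Union>n. A n) = X"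
  proof
    show "X \<subseteq> (\<Union>n. A n)"
    proof
      fix x assume x: "x \<in> X"
      then have "0 < \<phi> x" using \<phi> by auto
      then obtain r :: real where r: "0 < r" "ennreal r < \<phi> x"
        by (metis dense ennreal_cases ennreal_less_zero_iff infinity_ennreal_def not_less_iff_gr_or_eq top_greatest leD)
      obtain n where "1 / Suc n < r" using reals_Archimedean[OF r(1)] by (auto simp: inverse_eq_divide)
      then have "ennreal (1 / Suc n) < \<phi> x" using r(2) le_less_trans[OF ennreal_leI] by (metis less_imp_le)
      then show "x \<in> (\<Union>n. A n)" using x by (auto simp: A_def)
    qed
  qed (auto simp: A_def)
  finally have "emeasure lborel X = (SUP n. emeasure lborel (A n))" by simp
  also have "\<dots> \<le> ennreal y"
    using rearrangement_superlevel_le[OF rearr X(2) y(1)] zero y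
    by (intro SUP_least) (auto simp: A_def superlevel_emeasure[OF X(2)] intro!: ennreal_leI)
  finally have "ennreal (measure lborel X) \<le> ennreal y"
    using emeasure_bounded_finite[OF X(2)] by (simp add: emeasure_eq_ennreal_measure)
  then show False using y by simp
qed


text \<open>A decreasing function that is infinite at \<open>s\<close> is infinite on all of \<open>(0, s]\<close>, which the
  integrability of its logarithm near \<open>0\<close> excludes.\<close>

lemma rearrangement_finite:
  fixes \<phi>' :: "real \<Rightarrow> ennreal"
  assumes anti: "antimono_on {0<..} \<phi>'"
    and int: "(\<integral>\<^sup>+t\<in>{0<..<1}. log_plus (\<phi>' (t ^ p)) \<partial>lborel) < \<infinity>"
    and p: "0 < p" and s: "0 < s"
  shows "\<phi>' s < \<infinity>"
proof (rule ccontr)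
  assume "\<not> \<phi>' s < \<infinity>"
  then have inf: "\<phi>' s = \<infinity>" by (simp add: less_top[symmetric])
  define a where "a = min 1 (root p s)"
  have a: "0 < a" "a \<le> 1" using s p by (auto simp: a_def)
  have "\<infinity> * indicator {0<..<a} t \<le> log_plus (\<phi>' (t ^ p)) * indicator {0<..<1} t" for t
  proof (cases "t \<in> {0<..<a}")
    case True
    then have "t < root p s" by (simp add: a_def)
    then have "t ^ p < s"
      using p s True by (metis greaterThanLessThan_iff less_imp_le power_strict_mono real_root_pow_pos2)
    then have "\<phi>' s \<le> \<phi>' (t ^ p)" using True s by (intro monotone_onD[OF anti]) auto
    then have "log_plus (\<phi>' (t ^ p)) = \<infinity>" using inf by (simp add: log_plus_def top_unique)
    then show ?thesis using True a by simp
  qed simp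
  then have "(\<integral>\<^sup>+t. \<infinity> * indicator {0<..<a} t \<partial>lborel) \<le>
      (\<integral>\<^sup>+t\<in>{0<..<1}. log_plus (\<phi>' (t ^ p)) \<partial>lborel)"
    by (intro nn_integral_mono)
  also have "(\<integral>\<^sup>+t. \<infinity> * indicator {0<..<a} t \<partial>lborel) = \<infinity>"
    using a by (subst nn_integral_cmult_indicator) (auto simp: ennreal_top_mult)
  finally show False using int by (simp add: top_unique)
qed

lemma antimono_on_borel_measurable_indicator:
  fixes f :: "real \<Rightarrow> real"
  assumes "antimono_on A f" "A \<in> sets borel"
  shows "(\<lambda>x. indicator A x *\<^sub>R f x) \<in> borel_measurable lborel"
proof -
  have "mono_on A (\<lambda>x. - f x)"
    using assms(1) by (auto simp: monotone_on_def)
  then have "(\<lambda>x. - f x) \<in> borel_measurable (restrict_space borel A)"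
    by (rule borel_measurable_mono_on_fnc)
  then have "(\<lambda>x. - (- f x)) \<in> borel_measurable (restrict_space borel A)"
    by (rule borel_measurable_uminus)
  then show ?thesis using assms(2)
    by (subst (asm) borel_measurable_restrict_space_iff) auto
qed

text \<open>
  Near \<open>0\<close> the logarithm is controlled by the integrability hypothesis on \<open>(0, 1)\<close>; if \<open>t > 1\<close>, it
  is bounded by monotonicity on the remaining \<open>[1, t)\<close>. Without integrability the Bochner
  integral would be \<open>0\<close> by default and could not serve as an upper bound.
\<close>

lemma set_integrable_log_ratio:
  fixes \<phi>' :: "real \<Rightarrow> ennreal"
  assumes anti: "antimono_on {0<..} \<phi>'" and p: "0 < p"
    and int: "(\<integral>\<^sup>+t\<in>{0<..<1}. log_plus (\<phi>' (t ^ p)) \<partial>lborel) < \<infinity>"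
    and t: "0 < t" "0 < \<phi>' (t ^ p)"
  shows "set_integrable lborel {0<..<t} (\<lambda>s. ln (enn2real (\<phi>' (s ^ p) / \<phi>' (t ^ p))))"
proof -
  define f where "f s = enn2real (\<phi>' s)" for s
  have \<phi>'_eq: "\<phi>' s = ennreal (f s)" if "0 < s" for s
    using rearrangement_finite[OF anti int p that] by (simp add: f_def)
  have f_nn: "0 \<le> f s" for s by (simp add: f_def)
  have f_anti: "f s' \<le> f s" if "0 < s" "s \<le> s'" for s s'
    using monotone_onD[OF anti, of s s'] that f_nn by (simp add: \<phi>'_eq)
  have f0: "0 < f (t ^ p)" using t by (simp add: \<phi>'_eq)
  have ratio: "enn2real (\<phi>' (s ^ p) / \<phi>' (t ^ p)) = f (s ^ p) / f (t ^ p)" if "0 < s" for s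
    using that t f0 f_nn by (simp add: \<phi>'_eq divide_ennreal)
  have pow_mono: "0 < s ^ p \<and> s ^ p \<le> s' ^ p" if "0 < s" "s \<le> s'" for s s' :: real
    using that by (simp add: power_mono)
  define g where "g s = ln (f (s ^ p) / f (t ^ p))" for s
  have f_pos: "f (t ^ p) \<le> f (s ^ p)" if "0 < s" "s \<le> t" for s
    using f_anti pow_mono that by blast
  have g_nn: "0 \<le> g s" if "0 < s" "s < t" for s
    using f_pos[of s] that f0 by (simp add: g_def)
  have g_anti: "antimono_on {0<..<t} g"
  proof (rule monotone_onI)
    fix r s assume rs: "r \<in> {0<..<t}" "s \<in> {0<..<t}" "r \<le> s"
    have "f (s ^ p) \<le> f (r ^ p)" using f_anti pow_mono rs by simp
    then show "g s \<le> g r" using f_pos[of s] rs f0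
      by (auto simp: g_def intro!: ln_mono divide_right_mono)
  qed
  define h where "h s = ln (max (f (s ^ p)) 1)" for s
  have h_anti: "antimono_on {0<..<1} h"
  proof (rule monotone_onI)
    fix r s :: real assume rs: "r \<in> {0<..<1}" "s \<in> {0<..<1}" "r \<le> s"
    have "f (s ^ p) \<le> f (r ^ p)" using f_anti pow_mono rs by simp
    then show "h s \<le> h r" by (auto simp: h_def)
  qed
  have h_nn: "0 \<le> h s" for s by (simp add: h_def)
  define K where "K = \<bar>ln (f (t ^ p))\<bar> + \<bar>g 1\<bar>"
  have bound: "g s \<le> indicator {0<..<1} s * h s + K" if s: "0 < s" "s < t" for s
  proof (cases "s < 1")
    case True
    have "0 < f (s ^ p)" using f_pos[of s] s f0 by simp
    then have "g s = ln (f (s ^ p)) - ln (f (t ^ p))" using f0 by (simp add: g_def ln_div)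
    also have "ln (f (s ^ p)) \<le> h s" using \<open>0 < f (s ^ p)\<close> by (simp add: h_def)
    finally show ?thesis using True s by (simp add: K_def)
  next
    case False
    then have "g s \<le> g 1" using s by (intro monotone_onD[OF g_anti]) auto
    then show ?thesis using False by (simp add: K_def)
  qed
  have m: "(\<lambda>s. indicator {0<..<t} s *\<^sub>R g s) \<in> borel_measurable lborel"
    by (rule antimono_on_borel_measurable_indicator[OF g_anti]) simp
  have mh: "(\<lambda>s. indicator {0<..<1} s *\<^sub>R h s) \<in> borel_measurable lborel"
    by (rule antimono_on_borel_measurable_indicator[OF h_anti]) simp
  have "(\<integral>\<^sup>+s. ennreal (norm (indicator {0<..<t} s *\<^sub>R g s)) \<partial>lborel) \<le>
      (\<integral>\<^sup>+s. ennreal (indicator {0<..<1} s *\<^sub>R h s) + ennreal K * indicator {0<..<t} s \<partial>lborel)"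
  proof (rule nn_integral_mono)
    fix s
    show "ennreal (norm (indicator {0<..<t} s *\<^sub>R g s)) \<le>
      ennreal (indicator {0<..<1} s *\<^sub>R h s) + ennreal K * indicator {0<..<t} s"
    proof (cases "s \<in> {0<..<t}")
      case True
      then have "ennreal (norm (indicator {0<..<t} s *\<^sub>R g s)) = ennreal (g s)"
        using g_nn[of s] by simp
      also have "\<dots> \<le> ennreal (indicator {0<..<1} s * h s + K)"
        using bound[of s] True by (intro ennreal_leI) auto
      also have "\<dots> = ennreal (indicator {0<..<1} s *\<^sub>R h s) + ennreal K * indicator {0<..<t} s"
        using True h_nn by (simp add: K_def)
      finally show ?thesis .
    qed simp
  qed
  also have "\<dots> = (\<integral>\<^sup>+s. ennreal (indicator {0<..<1} s *\<^sub>R h s) \<partial>lborel) + ennreal K * ennreal t"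
    using mh t by (subst nn_integral_add) (auto simp: nn_integral_cmult_indicator)
  also have "(\<integral>\<^sup>+s. ennreal (indicator {0<..<1} s *\<^sub>R h s) \<partial>lborel) =
      (\<integral>\<^sup>+s\<in>{0<..<1}. log_plus (\<phi>' (s ^ p)) \<partial>lborel)"
    by (intro nn_integral_cong)
      (auto simp: log_plus_def \<phi>'_eq f_nn h_def indicator_def)
  also have "\<dots> + ennreal K * ennreal t < \<infinity>"
    using int by (simp add: ennreal_mult_less_top)
  finally have "set_integrable lborel {0<..<t} g"
    unfolding set_integrable_def using m by (intro integrableI_bounded)
  then show ?thesis
    by (rule set_integrable_cong[THEN iffD1, rotated -1]) (auto simp: g_def ratio)
qed

text \<open>Only the largest index \<open>j < n\<close> with \<open>P j\<close> matters: at most \<open>j + 1\<close> summands are nonzero.\<close>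

lemma sum_le_of_initial_multiples:
  fixes a b :: real
  assumes "0 \<le> a" "0 \<le> b" "\<And>j. P j \<Longrightarrow> Suc j * a \<le> b"
  shows "(\<Sum>j<n. if P j then a else 0) \<le> b"
proof (induction n)
  case (Suc n)
  show ?case
  proof (cases "P n")
    case True
    have "(\<Sum>j<Suc n. if P j then a else 0) \<le> (\<Sum>j<Suc n. a)"
      using assms(1) by (intro sum_mono) auto
    also have "\<dots> \<le> b" using assms(3)[OF True] by simp
    finally show ?thesis .
  qed (use Suc in simp)
qed (use assms in simp)

text \<open>
  The sum of the lengths \<open>N j\<close> is the integral of the function that counts the intervals
  \<open>(0, N j)\<close> containing a point, and the hypothesis \<open>level\<close> bounds \<open>a\<close> times that count by
  \<open>g - \<kappa>\<close>.
  The surplus \<open>\<kappa>\<close> over the whole interval \<open>(0, n0)\<close> is kept, since it later makes an inequality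
  strict.
\<close>

lemma sum_lengths_le_integral:
  fixes g :: "real \<Rightarrow> real" and N :: "nat \<Rightarrow> real" and a \<kappa> n0 t :: real
  assumes g: "set_integrable lborel {0<..<t} g" "\<And>s. 0 < s \<Longrightarrow> s < t \<Longrightarrow> 0 \<le> g s"
    and n0: "0 \<le> n0" "n0 \<le> t" and N: "\<And>j. 0 \<le> N j" "\<And>j. N j \<le> n0"
    and a: "0 \<le> a"
    and base: "\<And>s. 0 < s \<Longrightarrow> s < n0 \<Longrightarrow> \<kappa> \<le> g s"
    and level: "\<And>s j. 0 < s \<Longrightarrow> s < N j \<Longrightarrow> \<kappa> + Suc j * a \<le> g s"
  shows "a * (\<Sum>j<n. N j) + \<kappa> * n0 \<le> (LBINT s:{0<..<t}. g s)"
proof -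
  define F where "F s = (\<Sum>j<n. a * indicator {0<..<N j} s) + \<kappa> * indicator {0<..<n0} s" for s :: real
  have fin: "emeasure lborel {0<..<c::real} < \<infinity>" if "0 \<le> c" for c using that by simp
  have "integrable lborel (indicator {0<..<c::real} :: real \<Rightarrow> real)" if "0 \<le> c" for c
    using fin[OF that] by (intro integrable_real_indicator) auto
  then have iF: "integrable lborel F"
    unfolding F_def using N n0 by (intro Bochner_Integration.integrable_add Bochner_Integration.integrable_sum
        integrable_mult_right) auto
  have "integral\<^sup>L lborel F = a * (\<Sum>j<n. N j) + \<kappa> * n0"
  proof -
    have ind: "integrable lborel (\<lambda>s. b * indicator {0<..<c::real} s :: real)"
      and ind_val: "(\<integral>s. b * indicator {0<..<c} s \<partial>lborel) = b * c" if "0 \<le> c" for b c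
      using fin[OF that] that by (auto intro!: integrable_mult_right integrable_real_indicator)
    have "integral\<^sup>L lborel F = (\<integral>s. (\<Sum>j<n. a * indicator {0<..<N j} s) \<partial>lborel)
        + (\<integral>s. \<kappa> * indicator {0<..<n0} s \<partial>lborel)"
      unfolding F_def using N n0
      by (intro Bochner_Integration.integral_add Bochner_Integration.integrable_sum ind)
    also have "(\<integral>s. (\<Sum>j<n. a * indicator {0<..<N j} s) \<partial>lborel)
        = (\<Sum>j<n. \<integral>s. a * indicator {0<..<N j} s \<partial>lborel)"
      using N by (intro Bochner_Integration.integral_sum ind)
    also have "\<dots> = a * (\<Sum>j<n. N j)"
      unfolding ind_val[OF N(1)] by (simp add: sum_distrib_left)
    finally show ?thesis unfolding ind_val[OF n0(1)] .
  qed
  moreover have "integral\<^sup>L lborel F \<le> (\<integral>s. indicator {0<..<t} s *\<^sub>R g s \<partial>lborel)"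
  proof (rule integral_mono[OF iF])
    show "integrable lborel (\<lambda>s. indicator {0<..<t} s *\<^sub>R g s)"
      using g(1) by (simp add: set_integrable_def)
    fix s
    show "F s \<le> indicator {0<..<t} s *\<^sub>R g s"
    proof (cases "0 < s \<and> s < n0")
      case True
      have "(\<Sum>j<n. a * indicator {0<..<N j} s) = (\<Sum>j<n. if s < N j then a else 0)"
        using True by (intro sum.cong) (auto simp: indicator_def)
      also have "\<dots> \<le> g s - \<kappa>"
        using a base[of s] level[of s] True by (intro sum_le_of_initial_multiples) (auto simp: algebra_simps)
      finally show ?thesis using True n0 by (simp add: F_def)
    next
      case False
      then have "indicator {0<..<N j} s = (0::real)" for j using N(2)[of j] by (auto simp: indicator_def)
      then have "F s = 0" using False by (auto simp: F_def indicator_def)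
      then show ?thesis using g(2)[of s] by (auto simp: indicator_def)
    qed
  qed
  ultimately show ?thesis by (simp add: set_lebesgue_integral_def)
qed

text \<open>In the form of an infimum, \<open>\<phi>'(x-) < c\<close> yields a point \<open>y < x\<close> with \<open>\<phi>'(y) < c\<close> at once.\<close>

lemma antimono_Lim_at_left:
  fixes f :: "real \<Rightarrow> ennreal"
  assumes anti: "antimono_on {0<..} f" and x: "0 < x"
  shows "Lim (at_left x) f = (INF y\<in>{0<..<x}. f y)"
proof (rule tendsto_Lim)
  show "(f \<longlongrightarrow> (INF y\<in>{0<..<x}. f y)) (at_left x)"
  proof (rule order_tendstoI)
    fix a assume "a < (INF y\<in>{0<..<x}. f y)"
    then have "a < f y" if "0 < y" "y < x" for y
      using that by (meson INF_lower greaterThanLessThan_iff less_le_trans)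
    moreover have "\<forall>\<^sub>F y in at_left x. y \<in> {0<..<x}"
      using x by (rule eventually_at_leftI[rotated]) simp
    ultimately show "\<forall>\<^sub>F y in at_left x. a < f y"
      by (auto elim!: eventually_mono)
  next
    fix a assume "(INF y\<in>{0<..<x}. f y) < a"
    then obtain y where y: "0 < y" "y < x" "f y < a" by (auto simp: INF_less_iff)
    have "\<forall>\<^sub>F r in at_left x. r \<in> {y<..<x}"
      using y(2) by (rule eventually_at_leftI[rotated]) simp
    then show "\<forall>\<^sub>F r in at_left x. f r < a"
    proof (rule eventually_mono)
      fix r assume r: "r \<in> {y<..<x}"
      have "f r \<le> f y" using r y by (intro monotone_onD[OF anti]) auto
      then show "f r < a" using y(3) by simp
    qed
  qed
qed simp


section \<open>Bounding minorants far from the boundary\<close>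

text \<open>
  If the bound failed at \<open>z\<close>, then \<open>M = u z\<close> would be positive and finite with
  \<open>L = (\<beta> - \<alpha>) M > \<phi>'(t\<^sup>p-)\<close>. Summing the lengths of the level intervals gives a bound \<open>B\<close> on the
  total of the radii that is strictly below the distance from \<open>z\<close> to the frontier, so that
  \<open>u z < M\<close> follows. Two different facts make it strict: when \<open>{\<phi>' > L}\<close> is not null, the
  surplus \<open>\<kappa> = log(L / \<phi>'(t\<^sup>p))\<close> is gained on it; when it is null, all radii vanish and the
  distance itself is positive.
\<close>

lemma minorant_le_of_deep:
  fixes X :: "'a::euclidean_space set" and Y :: "'b::euclidean_space set"
    and \<phi> :: "'a \<Rightarrow> ennreal" and \<phi>' :: "real \<Rightarrow> ennreal"
  assumes X: "open X" "bounded X" and Y: "open Y" "bounded Y"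
    and \<phi>: "\<phi> \<in> borel_measurable (restrict_space borel X)" "\<forall>x\<in>X. \<phi> x > 0"
    and rearr: "is_decreasing_rearrangement X \<phi> \<phi>'"
    and int: "(\<integral>\<^sup>+t\<in>{0<..<1}. log_plus (\<phi>' (t ^ DIM('a))) \<partial>lborel) < \<infinity>"
    and u: "u \<in> subharmonic_minorants X Y \<phi>" and z: "z \<in> X \<times> Y"
    and ab: "0 < \<alpha>" "\<alpha> < \<beta>" "\<beta> < 1"
    and t: "0 < t" "t ^ DIM('a) < measure lborel X"
    and deep: "root DIM('a) (unit_ball_vol (DIM('b)) / (\<alpha> * unit_ball_vol (DIM('a) + DIM('b))))
        * (LBINT s:{0<..<t}. ln (enn2real (\<phi>' (s ^ DIM('a)) / \<phi>' (t ^ DIM('a))))) / ln (1 / \<beta>)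
      \<le> infdist z (frontier (X \<times> Y))"
  shows "e2ennreal (u z) \<le> Lim (at_left (t ^ DIM('a))) \<phi>' / ennreal (\<beta> - \<alpha>)"
proof (rule ccontr)
  let ?p = "DIM('a)"
  assume "\<not> ?thesis"
  then have big: "Lim (at_left (t ^ ?p)) \<phi>' / ennreal (\<beta> - \<alpha>) < e2ennreal (u z)" by simp
  have anti: "antimono_on {0<..} \<phi>'" using rearr by (simp add: is_decreasing_rearrangement_def)
  define f where "f s = enn2real (\<phi>' s)" for s
  have \<phi>'_eq: "\<phi>' s = ennreal (f s)" if "0 < s" for s
    using rearrangement_finite[OF anti int _ that] by (simp add: f_def)
  have f_nn: "0 \<le> f s" for s by (simp add: f_def)
  have f_anti: "f s' \<le> f s" if "0 < s" "s \<le> s'" for s s'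
    using monotone_onD[OF anti, of s s'] that f_nn by (simp add: \<phi>'_eq)
  have tp: "0 < t ^ ?p" using t by simp
  have pos: "0 < \<phi>' (t ^ ?p)" by (rule rearrangement_pos[OF rearr X \<phi> tp t(2)])
  have f0: "0 < f (t ^ ?p)" using pos tp by (simp add: \<phi>'_eq)
  have "u z < \<infinity>"
    using u z by (auto simp: subharmonic_minorants_def subharmonic_on_def)
  moreover have "0 < u z"
    using big e2ennreal_neg[of "u z"] by (force simp: not_less)
  ultimately obtain M where M: "u z = ereal M" "0 < M" by (cases "u z") auto
  define L where "L = (\<beta> - \<alpha>) * M"
  have L: "0 < L" using ab M by (simp add: L_def)
  have "Lim (at_left (t ^ ?p)) \<phi>' < ennreal L"
  proof (cases "Lim (at_left (t ^ ?p)) \<phi>'")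
    case (real l)
    then have "ennreal (l / (\<beta> - \<alpha>)) < ennreal M" using big M ab by (simp add: divide_ennreal)
    then have "l / (\<beta> - \<alpha>) < M" using real ab by (simp add: ennreal_less_iff)
    then show ?thesis using real ab by (simp add: L_def ennreal_less_iff field_simps)
  next
    case top
    then show ?thesis using big by (simp add: ennreal_top_divide)
  qed
  then obtain y where y: "0 < y" "y < t ^ ?p" "\<phi>' y < ennreal L"
    by (auto simp: antimono_Lim_at_left[OF anti tp] INF_less_iff)
  then have fy: "f y < L" using f_nn by (simp add: \<phi>'_eq ennreal_less_iff)
  define \<kappa> where "\<kappa> = ln (L / f (t ^ ?p))"
  have "f (t ^ ?p) < L" using f_anti[of y "t ^ ?p"] y fy by simp
  then have \<kappa>: "\<kappa> > 0" using f0 by (simp add: \<kappa>_def)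
  define \<mu> where "\<mu> c = superlevel_content X \<phi> c" for c
  have \<mu>_nn: "0 \<le> \<mu> c" for c by (simp add: \<mu>_def superlevel_content_nonneg)
  \<comment> \<open>\<open>N j\<close> is the length of the interval for the level \<open>(1 - \<alpha>/\<beta>) (M/\<beta>\<^sup>j) = L/\<beta>\<^sup>j\<^sup>+\<^sup>1\<close> of the \<open>j\<close>-th jump.\<close>
  define n0 where "n0 = root ?p (\<mu> L)"
  define N where "N j = root ?p (\<mu> (L / \<beta> ^ Suc j))" for j
  have level: "c < f (s ^ ?p)" if "0 < s" "0 < c" "s < root ?p (\<mu> c)" for s c
  proof (rule ccontr)
    assume "\<not> c < f (s ^ ?p)"
    then have "\<mu> c \<le> s ^ ?p"
      unfolding \<mu>_def using that f_nn
      by (intro rearrangement_superlevel_le[OF rearr X(2)]) (auto simp: \<phi>'_eq intro!: ennreal_leI)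
    then have "root ?p (\<mu> c) \<le> root ?p (s ^ ?p)" by simp
    then show False using that by (simp add: real_root_power_cancel)
  qed
  have n0: "0 \<le> n0" "n0 \<le> t"
  proof -
    have "\<mu> L \<le> y"
      unfolding \<mu>_def using y L by (intro rearrangement_superlevel_le[OF rearr X(2)]) auto
    then have "root ?p (\<mu> L) \<le> root ?p (t ^ ?p)" using y by simp
    then show "n0 \<le> t" using t by (simp add: n0_def real_root_power_cancel)
  qed (simp add: n0_def \<mu>_nn)
  have N: "0 \<le> N j" "N j \<le> n0" for j
  proof -
    have "\<beta> ^ Suc j \<le> 1" using ab by (intro power_le_one) auto
    then have "L \<le> L / \<beta> ^ Suc j" using L ab by (simp add: field_simps del: power_Suc)
    then have "\<mu> (L / \<beta> ^ Suc j) \<le> \<mu> L"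
      unfolding \<mu>_def by (rule superlevel_content_antimono[OF X \<phi>(1)])
    then show "N j \<le> n0" by (simp add: N_def n0_def)
  qed (simp add: N_def \<mu>_nn)
  define a where "a = ln (1 / \<beta>)"
  have a: "0 < a" using ab by (simp add: a_def)
  define g where "g s = ln (enn2real (\<phi>' (s ^ ?p) / \<phi>' (t ^ ?p)))" for s
  have g_eq: "g s = ln (f (s ^ ?p) / f (t ^ ?p))" if "0 < s" for s
    using that tp f0 f_nn by (simp add: g_def \<phi>'_eq divide_ennreal)
  have g_ge: "ln (c / f (t ^ ?p)) \<le> g s" if "0 < s" "0 < c" "c \<le> f (s ^ ?p)" for s c
    using that f0 by (auto simp: g_eq intro!: ln_mono divide_right_mono)
  have key: "a * (\<Sum>j<n. N j) + \<kappa> * n0 \<le> (LBINT s:{0<..<t}. g s)" for n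
  proof (rule sum_lengths_le_integral[OF _ _ n0 N])
    show "set_integrable lborel {0<..<t} g"
      unfolding g_def using set_integrable_log_ratio[OF anti _ int t(1) pos] by simp
    show "0 \<le> g s" if "0 < s" "s < t" for s
    proof -
      have "f (t ^ ?p) \<le> f (s ^ ?p)" using that by (intro f_anti power_mono) auto
      then show ?thesis using g_ge[of s "f (t ^ ?p)"] that f0 by simp
    qed
    show "0 \<le> a" using a by simp
    show "\<kappa> \<le> g s" if "0 < s" "s < n0" for s
      unfolding \<kappa>_def using that level[of s L] L by (intro g_ge) (auto simp: n0_def)
    show "\<kappa> + real (Suc j) * a \<le> g s" if "0 < s" "s < N j" for s j
    proof -
      have c: "0 < L / \<beta> ^ Suc j" using L ab by simp
      have "ln (L / \<beta> ^ Suc j / f (t ^ ?p)) = \<kappa> + real (Suc j) * a"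
        using L ab f0 by (simp add: \<kappa>_def a_def ln_div ln_mult ln_realpow algebra_simps)
      then show ?thesis using g_ge[OF that(1) c] level[OF that(1) c] that(2) by (simp add: N_def)
    qed
  qed
  define I where "I = (LBINT s:{0<..<t}. g s)"
  define D where "D = infdist z (frontier (X \<times> Y))"
  define C where "C = unit_ball_vol (DIM('b)) / (\<alpha> * unit_ball_vol (DIM('a) + DIM('b)))"
  have C: "0 < root ?p C" using ab by (simp add: C_def)
  have deep': "root ?p C * I / a \<le> D"
    using deep by (simp add: C_def I_def g_def a_def D_def)
  have "0 < D"
  proof -
    have op: "open (X \<times> Y)" using X Y by (simp add: open_Times)
    have "X \<times> Y \<noteq> UNIV"
      using bounded_Times[OF X(2) Y(2)] not_bounded_UNIV by metis
    then have "frontier (X \<times> Y) \<noteq> {}" using z by (intro frontier_not_empty) auto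
    moreover have "z \<notin> frontier (X \<times> Y)" using op z by (auto simp: frontier_def interior_open)
    ultimately show ?thesis unfolding D_def by (intro infdist_pos_not_in_closed) auto
  qed
  define B where "B = (if n0 = 0 then 0 else root ?p C * (I - \<kappa> * n0) / a)"
  have "B < D"
  proof (cases "n0 = 0")
    case False
    then have "root ?p C * (\<kappa> * n0) / a > 0" using C \<kappa> n0 a by simp
    then have "B < root ?p C * I / a" using False by (simp add: B_def algebra_simps diff_divide_distrib)
    then show ?thesis using deep' by simp
  qed (use \<open>0 < D\<close> in \<open>simp add: B_def\<close>)
  moreover have "(\<Sum>j<n. root ?p (C * superlevel_content X \<phi> ((1 - \<alpha> / \<beta>) * (M / \<beta> ^ j)))) \<le> B" for n
  proof -
    have "(1 - \<alpha> / \<beta>) * (M / \<beta> ^ j) = L / \<beta> ^ Suc j" for j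
      using ab by (simp add: L_def field_simps)
    then have "(\<Sum>j<n. root ?p (C * superlevel_content X \<phi> ((1 - \<alpha> / \<beta>) * (M / \<beta> ^ j))))
        = root ?p C * (\<Sum>j<n. N j)"
      by (simp add: N_def \<mu>_def real_root_mult sum_distrib_left)
    also have "\<dots> \<le> B"
    proof (cases "n0 = 0")
      case True
      then have "N j = 0" for j using N[of j] by simp
      then show ?thesis using True by (simp add: B_def)
    next
      case False
      have "(\<Sum>j<n. N j) \<le> (I - \<kappa> * n0) / a" using key[of n] a by (simp add: I_def field_simps)
      then show ?thesis using False mult_left_mono[of _ _ "root ?p C"] C by (fastforce simp: B_def)
    qed
    finally show ?thesis .
  qed
  ultimately have "u z < ereal M"
    unfolding C_def D_def
    by (intro subharmonic_minorant_less[OF X \<phi>(1) u z ab M(2)])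
  then show False using M by simp
qed

theorem theorem3p1:
  fixes X :: "'a::euclidean_space set" and Y :: "'b::euclidean_space set"
    and \<phi> :: "'a \<Rightarrow> ennreal" and \<phi>' :: "real \<Rightarrow> ennreal"
  assumes "open X" "bounded X" "open Y" "bounded Y"
    and "\<phi> \<in> borel_measurable (restrict_space borel X)"
    and "\<forall>x\<in>X. \<phi> x > 0"
    and "is_decreasing_rearrangement X \<phi> \<phi>'"
    and "(\<integral>\<^sup>+t\<in>{0<..<1}. log_plus (\<phi>' (t ^ DIM('a))) \<partial>lborel) < \<infinity>"
  shows "\<exists>\<psi> :: real \<Rightarrow> ennreal.
    antimono_on {0..} \<psi> \<and>
    (\<forall>z \<in> X \<times> Y. (SUP u \<in> subharmonic_minorants X Y \<phi>. u z)
        \<le> enn2ereal (\<psi> (infdist z (frontier (X \<times> Y))))) \<and>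
    (\<forall>\<alpha> \<beta> t. 0 < \<alpha> \<and> \<alpha> < \<beta> \<and> \<beta> < 1 \<and>
        0 < t \<and> t < measure lborel X powr (1 / DIM('a)) \<longrightarrow>
      \<psi> (1 / (\<alpha> powr (1 / DIM('a)) * ln (1 / \<beta>))
          * (unit_ball_vol (DIM('b)) / unit_ball_vol (DIM('a) + DIM('b))) powr (1 / DIM('a))
          * (LBINT s:{0<..<t}. ln (enn2real (\<phi>' (s ^ DIM('a)) / \<phi>' (t ^ DIM('a))))))
        \<le> Lim (at_left (t ^ DIM('a))) \<phi>' / ennreal (\<beta> - \<alpha>))"
proof -
  let ?p = "DIM('a)" and ?Z = "X \<times> Y" and ?U = "subharmonic_minorants X Y \<phi>"
  define deep where "deep \<delta> = {(u, z). u \<in> ?U \<and> z \<in> ?Z \<and> \<delta> \<le> infdist z (frontier ?Z)}" for \<delta>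
  define \<psi> where "\<psi> \<delta> = (SUP (u, z)\<in>deep \<delta>. e2ennreal (u z))" for \<delta>
  have "antimono_on {0..} \<psi>"
    unfolding \<psi>_def deep_def by (intro monotone_onI SUP_subset_mono) auto
  moreover have "(SUP u \<in> ?U. u z) \<le> enn2ereal (\<psi> (infdist z (frontier ?Z)))" if z: "z \<in> ?Z" for z
  proof (rule SUP_least)
    fix u assume u: "u \<in> ?U"
    have "u z \<le> enn2ereal (e2ennreal (u z))"
      by (cases "0 \<le> u z") (auto simp: enn2ereal_e2ennreal intro: order_trans[OF _ enn2ereal_nonneg])
    also have "e2ennreal (u z) \<le> \<psi> (infdist z (frontier ?Z))"
      unfolding \<psi>_def using u z by (intro SUP_upper2[of "(u, z)"]) (auto simp: deep_def)
    finally show "u z \<le> enn2ereal (\<psi> (infdist z (frontier ?Z)))"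
      by (simp add: less_eq_ennreal.rep_eq)
  qed
  moreover have "\<psi> (1 / (\<alpha> powr (1 / ?p) * ln (1 / \<beta>))
          * (unit_ball_vol (DIM('b)) / unit_ball_vol (DIM('a) + DIM('b))) powr (1 / ?p)
          * (LBINT s:{0<..<t}. ln (enn2real (\<phi>' (s ^ ?p) / \<phi>' (t ^ ?p)))))
        \<le> Lim (at_left (t ^ ?p)) \<phi>' / ennreal (\<beta> - \<alpha>)"
    if ab: "0 < \<alpha>" "\<alpha> < \<beta>" "\<beta> < 1" and t: "0 < t" "t < measure lborel X powr (1 / ?p)" for \<alpha> \<beta> t
  proof -
    have "t ^ ?p < measure lborel X"
    proof -
      have "t < root ?p (measure lborel X)" using t by (simp add: root_powr_inverse)
      then have "t ^ ?p < root ?p (measure lborel X) ^ ?p"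
        using t by (intro power_strict_mono) auto
      then show ?thesis by simp
    qed
    note bound = minorant_le_of_deep[OF assms _ _ ab t(1) this]
    have "1 / (\<alpha> powr (1 / ?p) * ln (1 / \<beta>))
          * (unit_ball_vol (DIM('b)) / unit_ball_vol (DIM('a) + DIM('b))) powr (1 / ?p)
        = root ?p (unit_ball_vol (DIM('b)) / (\<alpha> * unit_ball_vol (DIM('a) + DIM('b)))) / ln (1 / \<beta>)"
      using ab by (simp add: root_powr_inverse[symmetric] real_root_divide real_root_mult)
    then show ?thesis
      unfolding \<psi>_def by (intro SUP_least) (auto simp: deep_def intro!: bound)
  qed
  ultimately show ?thesis by blast
qed

end
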